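(* Let $k\ge 2$, and let $(u_h,\phi_h)=(u_h(t),\phi_h(t))\in V_h^k\times V_h^k$, $t\in[0,T]$, be a solution of the semi-discrete ultra-weak discontinuous Galerkin scheme: for all $(v_h,\psi_h)\in V_h^k\times V_h^k$ and all $j=1,\dots,N$, $$\int_{I_j}(u_h)_t\,v_h\,dx + D_{u,j}((u_h,\phi_h),v_h)=0,\qquad \int_{I_j}(\phi_h)_t\,\psi_h\,dx - D_{\phi,j}((u_h,\phi_h),\psi_h)=0,$$ where $V_h^k$, $D_{u,j}$ and $D_{\phi,j}$ (including the numerical fluxes) are as defined in the context. Then the energy $$E_h(t)=\int_I\big((u_h)^2+(\phi_h)^2\big)\,dx$$ is conserved for all time, i.e. $E_h(t)=E_h(0)$ for all $t\in[0,T]$.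
   Context: The scheme discretizes the equation $u_t+\epsilon u_{xxx}=0$ on $I\times(0,T]$, $I=[0,1]$, with periodic boundary conditions and initial condition $u(x,0)=u_0(x)$ (smooth and periodic), where $\epsilon\neq 0$ is a real constant. The equation is augmented by an auxiliary zero function $\phi$ satisfying $\phi_t-\epsilon\phi_{xxx}=0$, $\phi(x,0)=0$. Mesh: $0=x_{1/2}<x_{3/2}<\cdots<x_{N+1/2}=1$, $I_j=(x_{j-1/2},x_{j+1/2})$, $h_j=x_{j+1/2}-x_{j-1/2}$, $h=\max_j h_j$, $\rho=\min_j h_j$, and the mesh is regular: there is a constant $\gamma>0$ such that $\gamma h\le\rho\le h$ during mesh refinement. Finite element space: $V_h^k=\{v\in L^2(I): v|_{I_j}\in P^k(I_j),\ j=1,\dots,N\}$, where $P^k(I_j)$ is the set of polynomials of degree at most $k$ on $I_j$, $k\ge 2$. Derivatives $(\cdot)_x,(\cdot)_{xx},(\cdot)_{xxx}$ of functions in $V_h^k$ are taken cellwise. Traces: for a piecewise smooth $p$, $p^-_{j+1/2}$ and $p^+_{j+1/2}$ are the values at $x_{j+1/2}$ from the left cell $I_j$ and from the right cell $I_{j+1}$, respectively; by periodicity the points $x_{1/2}$ and $x_{N+1/2}$ are identified (so $I_0=I_N$ and $I_{N+1}=I_1$). At each cell boundary point, the jump is $[p]=p^+-p^-$ and the mean is $\{p\}=\tfrac12(p^++p^-)$. Operators: $$\begin{aligned}D_{u,j}((u_h,\phi_h),v_h)=&-\epsilon\int_{I_j}u_h(v_h)_{xxx}\,dx+\epsilon\big(\widehat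 u_h (v_h)_{xx}^- -\widehat u_{h,x}(v_h)_x^-+\widehat u_{h,xx}(v_h)^-\big)\big|_{x_{j+1/2}}\\&-\epsilon\big(\widehat u_h (v_h)_{xx}^+ -\widehat u_{h,x}(v_h)_x^++\widehat u_{h,xx}(v_h)^+\big)\big|_{x_{j-1/2}},\end{aligned}$$ $$\begin{aligned}D_{\phi,j}((u_h,\phi_h),\psi_h)=&-\epsilon\int_{I_j}\phi_h(\psi_h)_{xxx}\,dx+\epsilon\big(\widehat \phi_h (\psi_h)_{xx}^- -\widehat \phi_{h,x}(\psi_h)_x^-+\widehat \phi_{h,xx}(\psi_h)^-\big)\big|_{x_{j+1/2}}\\&-\epsilon\big(\widehat \phi_h (\psi_h)_{xx}^+ -\widehat \phi_{h,x}(\psi_h)_x^++\widehat \phi_{h,xx}(\psi_h)^+\big)\big|_{x_{j-1/2}}.\end{aligned}$$ Numerical fluxes at each cell boundary point: $$\widehat u_h=\{u_h\}+\tfrac12[\phi_h],\quad \widehat\phi_h=\{\phi_h\}+\tfrac12[u_h],$$ $$\widehat u_{h,x}=\{(u_h)_x\}+\tfrac12[(\phi_h)_x],\quad \widehat\phi_{h,x}=\{(\phi_h)_x\}+\tfrac12[(u_h)_x],$$ $$\widehat u_{h,xx}=\{(u_h)_{xx}\}+\tfrac12[(\phi_h)_{xx}],\quad \widehat\phi_{h,xx}=\{(\phi_h)_{xx}\}+\tfrac12[(u_h)_{xx}].$$ *)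

theory Defs
  imports "HOL-Analysis.Analysis" "HOL-Computational_Algebra.Polynomial"
begin

text \<open>
  A mesh of the unit interval with \<open>N\<close> cells is given by its nodes \<open>x 0, \<dots>, x N\<close>, where
  \<open>x j\<close> stands for $x_{j+1/2}$; only the indices \<open>0, \<dots>, N\<close> are meaningful.  Cells carry the
  indices \<open>1, \<dots>, N\<close>.
\<close>

definition mesh :: "nat \<Rightarrow> (nat \<Rightarrow> real) \<Rightarrow> bool" where
  "mesh N x \<longleftrightarrow> N \<ge> 1 \<and> x 0 = 0 \<and> x N = 1 \<and> strict_mono_on {0..N} x"

definition cell :: "(nat \<Rightarrow> real) \<Rightarrow> nat \<Rightarrow> real set" where
  "cell x j = {x (j - 1)<..<x j}"

definition cell_size :: "(nat \<Rightarrow> real) \<Rightarrow> nat \<Rightarrow> real" where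
  "cell_size x j = x j - x (j - 1)"

definition mesh_h :: "nat \<Rightarrow> (nat \<Rightarrow> real) \<Rightarrow> real" where
  "mesh_h N x = Max (cell_size x ` {1..N})"

definition mesh_rho :: "nat \<Rightarrow> (nat \<Rightarrow> real) \<Rightarrow> real" where
  "mesh_rho N x = Min (cell_size x ` {1..N})"

definition regular_mesh :: "real \<Rightarrow> nat \<Rightarrow> (nat \<Rightarrow> real) \<Rightarrow> bool" where
  "regular_mesh \<gamma> N x \<longleftrightarrow>
     mesh N x \<and> \<gamma> > 0 \<and> \<gamma> * mesh_h N x \<le> mesh_rho N x \<and> mesh_rho N x \<le> mesh_h N x"

text \<open>
  Elements of the finite element space are represented by functions that are polynomial at every
  point of each open cell; their values at the nodes and outside the unit interval are arbitrary
  and play no role below.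
\<close>

definition fe_space :: "nat \<Rightarrow> nat \<Rightarrow> (nat \<Rightarrow> real) \<Rightarrow> (real \<Rightarrow> real) set" where
  "fe_space k N x = {v.
     v \<in> borel_measurable (lebesgue_on {0..1}) \<and>
     integrable (lebesgue_on {0..1}) (\<lambda>y. (v y)\<^sup>2) \<and>
     (\<forall>j\<in>{1..N}. \<exists>p::real poly. degree p \<le> k \<and> (\<forall>y\<in>cell x j. v y = poly p y))}"

text \<open>
  As the cells are open, the ordinary iterated derivative is the cellwise derivative at all points
  other than the nodes.
\<close>

definition dx :: "nat \<Rightarrow> (real \<Rightarrow> real) \<Rightarrow> real \<Rightarrow> real" where
  "dx i v = (deriv ^^ i) v"

text \<open>
  Traces at the node \<open>x j\<close>.  By periodicity the left neighbour of \<open>x 0\<close> is the last cell, and the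
  right neighbour of \<open>x N\<close> is the first cell.
\<close>

definition trace_minus :: "nat \<Rightarrow> (nat \<Rightarrow> real) \<Rightarrow> (real \<Rightarrow> real) \<Rightarrow> nat \<Rightarrow> real" where
  "trace_minus N x p j = Lim (at_left (x (if j = 0 then N else j))) p"

definition trace_plus :: "nat \<Rightarrow> (nat \<Rightarrow> real) \<Rightarrow> (real \<Rightarrow> real) \<Rightarrow> nat \<Rightarrow> real" where
  "trace_plus N x p j = Lim (at_right (x (if j = N then 0 else j))) p"

definition jump :: "nat \<Rightarrow> (nat \<Rightarrow> real) \<Rightarrow> (real \<Rightarrow> real) \<Rightarrow> nat \<Rightarrow> real" where
  "jump N x p j = trace_plus N x p j - trace_minus N x p j"

definition mean :: "nat \<Rightarrow> (nat \<Rightarrow> real) \<Rightarrow> (real \<Rightarrow> real) \<Rightarrow> nat \<Rightarrow> real" where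
  "mean N x p j = (trace_plus N x p j + trace_minus N x p j) / 2"

text \<open>
  The fluxes for the \<open>i\<close>-th derivative, \<open>i = 0, 1, 2\<close>.
\<close>

definition flux_u ::
  "nat \<Rightarrow> (nat \<Rightarrow> real) \<Rightarrow> (real \<Rightarrow> real) \<times> (real \<Rightarrow> real) \<Rightarrow> nat \<Rightarrow> nat \<Rightarrow> real" where
  "flux_u N x = (\<lambda>(u, \<phi>) i j. mean N x (dx i u) j + jump N x (dx i \<phi>) j / 2)"

definition flux_phi ::
  "nat \<Rightarrow> (nat \<Rightarrow> real) \<Rightarrow> (real \<Rightarrow> real) \<times> (real \<Rightarrow> real) \<Rightarrow> nat \<Rightarrow> nat \<Rightarrow> real" where
  "flux_phi N x = (\<lambda>(u, \<phi>) i j. mean N x (dx i \<phi>) j + jump N x (dx i u) j / 2)"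

definition D_u ::
  "real \<Rightarrow> nat \<Rightarrow> (nat \<Rightarrow> real) \<Rightarrow> nat \<Rightarrow> (real \<Rightarrow> real) \<times> (real \<Rightarrow> real) \<Rightarrow> (real \<Rightarrow> real) \<Rightarrow> real"
where
  "D_u \<epsilon> N x j = (\<lambda>(u, \<phi>) v.
     - \<epsilon> * integral (cell x j) (\<lambda>y. u y * dx 3 v y)
     + \<epsilon> * (flux_u N x (u, \<phi>) 0 j * trace_minus N x (dx 2 v) j
          - flux_u N x (u, \<phi>) 1 j * trace_minus N x (dx 1 v) j
          + flux_u N x (u, \<phi>) 2 j * trace_minus N x v j)
     - \<epsilon> * (flux_u N x (u, \<phi>) 0 (j - 1) * trace_plus N x (dx 2 v) (j - 1)
          - flux_u N x (u, \<phi>) 1 (j - 1) * trace_plus N x (dx 1 v) (j - 1)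
          + flux_u N x (u, \<phi>) 2 (j - 1) * trace_plus N x v (j - 1)))"

definition D_phi ::
  "real \<Rightarrow> nat \<Rightarrow> (nat \<Rightarrow> real) \<Rightarrow> nat \<Rightarrow> (real \<Rightarrow> real) \<times> (real \<Rightarrow> real) \<Rightarrow> (real \<Rightarrow> real) \<Rightarrow> real"
where
  "D_phi \<epsilon> N x j = (\<lambda>(u, \<phi>) \<psi>.
     - \<epsilon> * integral (cell x j) (\<lambda>y. \<phi> y * dx 3 \<psi> y)
     + \<epsilon> * (flux_phi N x (u, \<phi>) 0 j * trace_minus N x (dx 2 \<psi>) j
          - flux_phi N x (u, \<phi>) 1 j * trace_minus N x (dx 1 \<psi>) j
          + flux_phi N x (u, \<phi>) 2 j * trace_minus N x \<psi> j)
     - \<epsilon> * (flux_phi N x (u, \<phi>) 0 (j - 1) * trace_plus N x (dx 2 \<psi>) (j - 1)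
          - flux_phi N x (u, \<phi>) 1 (j - 1) * trace_plus N x (dx 1 \<psi>) (j - 1)
          + flux_phi N x (u, \<phi>) 2 (j - 1) * trace_plus N x \<psi> (j - 1)))"

text \<open>
  Time-dependent functions take the time as first argument.  The time derivative is one-sided at
  the end points of \<open>{0..T}\<close>; it is taken at fixed points of the open cells, which for functions
  with values in the finite element space amounts to differentiability of the coefficients.
\<close>

definition dt :: "real \<Rightarrow> (real \<Rightarrow> real \<Rightarrow> real) \<Rightarrow> real \<Rightarrow> real \<Rightarrow> real" where
  "dt T w t y = vector_derivative (\<lambda>s. w s y) (at t within {0..T})"

definition fe_evolution ::
  "nat \<Rightarrow> nat \<Rightarrow> (nat \<Rightarrow> real) \<Rightarrow> real \<Rightarrow> (real \<Rightarrow> real \<Rightarrow> real) \<Rightarrow> bool" where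
  "fe_evolution k N x T w \<longleftrightarrow>
     (\<forall>t\<in>{0..T}. w t \<in> fe_space k N x \<and>
        (\<forall>j\<in>{1..N}. \<forall>y\<in>cell x j. (\<lambda>s. w s y) differentiable (at t within {0..T})))"

definition uwdg_solution ::
  "real \<Rightarrow> nat \<Rightarrow> nat \<Rightarrow> (nat \<Rightarrow> real) \<Rightarrow> real \<Rightarrow> (real \<Rightarrow> real \<Rightarrow> real) \<Rightarrow> (real \<Rightarrow> real \<Rightarrow> real) \<Rightarrow> bool"
where
  "uwdg_solution \<epsilon> k N x T u \<phi> \<longleftrightarrow>
     fe_evolution k N x T u \<and> fe_evolution k N x T \<phi> \<and>
     (\<forall>t\<in>{0..T}. \<forall>v\<in>fe_space k N x. \<forall>\<psi>\<in>fe_space k N x. \<forall>j\<in>{1..N}.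
        integral (cell x j) (\<lambda>y. dt T u t y * v y) + D_u \<epsilon> N x j (u t, \<phi> t) v = 0 \<and>
        integral (cell x j) (\<lambda>y. dt T \<phi> t y * \<psi> y) - D_phi \<epsilon> N x j (u t, \<phi> t) \<psi> = 0)"

definition energy :: "(real \<Rightarrow> real \<Rightarrow> real) \<Rightarrow> (real \<Rightarrow> real \<Rightarrow> real) \<Rightarrow> real \<Rightarrow> real" where
  "energy u \<phi> t = integral {0..1} (\<lambda>y. (u t y)\<^sup>2 + (\<phi> t y)\<^sup>2)"

end

theory Submission
  imports Defs
begin

text \<open>
  Testing the scheme with the solution itself turns the time derivative of the energy into
  \<open>-2 \<Sum>\<^sub>j (D\<^sub>u((u, \<phi>), u) - D\<^sub>\<phi>((u, \<phi>), \<phi>))\<close>, so everything depends on one spatial identity.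
  On a cell, \<open>u u\<^sub>x\<^sub>x\<^sub>x\<close> is the derivative of \<open>u u\<^sub>x\<^sub>x - u\<^sub>x\<^sup>2 / 2\<close>.  Hence
  \<open>\<Sum>\<^sub>j D\<^sub>u((u, \<phi>), u)\<close> consists of boundary terms only.  Collected node by node, the parts of these
  terms that come from the means in the fluxes cancel the jumps of \<open>u u\<^sub>x\<^sub>x - u\<^sub>x\<^sup>2 / 2\<close>, by the
  product rule \<open>[p q] = {p} [q] + {q} [p]\<close>, and the jump parts of the fluxes leave
  \<open>-\<epsilon>/2 \<Sum>\<^sub>j ([\<phi>] [u\<^sub>x\<^sub>x] - [\<phi>\<^sub>x] [u\<^sub>x] + [\<phi>\<^sub>x\<^sub>x] [u])\<close> (lemma \<open>sum_D_u_self\<close>).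
  This expression is symmetric in \<open>u\<close> and \<open>\<phi>\<close>, whereas \<open>D\<^sub>\<phi>\<close> arises from \<open>D\<^sub>u\<close> by exchanging the
  two unknowns (\<open>D_phi_eq_D_u_swap\<close>).  So the two sums agree, and the energy has derivative zero.

  The time derivative of a solution is only given pointwise in space.  It may nevertheless be moved
  out of the integral over a cell, because a polynomial of degree at most \<open>k\<close> is a fixed linear
  combination of its values at \<open>k + 1\<close> points of the cell (\<open>lagrange_interpolation\<close>).  The integral
  of its square is thus a quadratic form in finitely many differentiable functions of time
  (\<open>has_derivative_cell_energy\<close>).
\<close>

section \<open>Cellwise polynomials and their traces\<close>

lemma meshD:
  assumes "mesh N x" "j \<in> {1..N}"
  shows "x (j - 1) < x j"
  using assms unfolding mesh_def by (auto intro!: strict_mono_onD[of "{0..N}" x])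

lemma fe_space_polyE:
  assumes "v \<in> fe_space k N x" "j \<in> {1..N}"
  obtains p where "degree p \<le> k" "\<And>y. y \<in> cell x j \<Longrightarrow> v y = poly p y"
  using assms unfolding fe_space_def by blast

lemma dx_cell:
  assumes "\<And>y. y \<in> cell x j \<Longrightarrow> v y = poly p y" "y \<in> cell x j"
  shows "dx i v y = poly ((pderiv ^^ i) p) y"
  using assms(2)
proof (induction i arbitrary: y)
  case 0
  then show ?case using assms(1) by (simp add: dx_def)
next
  case (Suc i)
  have "eventually (\<lambda>z. z \<in> cell x j) (nhds y)"
    using Suc.prems by (intro eventually_nhds_in_open) (auto simp: cell_def)
  then have "eventually (\<lambda>z. dx i v z = poly ((pderiv ^^ i) p) z) (nhds y)"
    by eventually_elim (rule Suc.IH)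
  then have "deriv (dx i v) y = deriv (poly ((pderiv ^^ i) p)) y"
    by (rule deriv_cong_ev) simp
  also have "\<dots> = poly (pderiv ((pderiv ^^ i) p)) y"
    by (intro DERIV_imp_deriv poly_DERIV)
  finally show ?case by (simp add: dx_def)
qed

lemma trace_minus_cell:
  assumes "mesh N x" "j \<in> {1..N}" "\<And>y. y \<in> cell x j \<Longrightarrow> f y = poly q y"
  shows "trace_minus N x f j = poly q (x j)"
proof -
  have "(poly q \<longlongrightarrow> poly q (x j)) (at_left (x j))"
    using poly_isCont[of "x j" q] by (auto simp: isCont_def intro: tendsto_mono at_le)
  moreover have "eventually (\<lambda>y. poly q y = f y) (at_left (x j))"
    using eventually_at_left_field[of _ "x j"] meshD[OF assms(1,2)] assms(3)
    by (auto simp: cell_def intro!: exI[of _ "x (j - 1)"])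
  ultimately have "(f \<longlongrightarrow> poly q (x j)) (at_left (x j))"
    by (rule Lim_transform_eventually)
  then show ?thesis
    using assms(2) by (auto simp: trace_minus_def intro!: tendsto_Lim)
qed

lemma trace_plus_cell:
  assumes "mesh N x" "j \<in> {1..N}" "\<And>y. y \<in> cell x j \<Longrightarrow> f y = poly q y"
  shows "trace_plus N x f (j - 1) = poly q (x (j - 1))"
proof -
  have "(poly q \<longlongrightarrow> poly q (x (j - 1))) (at_right (x (j - 1)))"
    using poly_isCont[of "x (j - 1)" q] by (auto simp: isCont_def intro: tendsto_mono at_le)
  moreover have "eventually (\<lambda>y. poly q y = f y) (at_right (x (j - 1)))"
    using eventually_at_right_field[of _ "x (j - 1)"] meshD[OF assms(1,2)] assms(3)
    by (auto simp: cell_def intro!: exI[of _ "x j"])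
  ultimately have "(f \<longlongrightarrow> poly q (x (j - 1))) (at_right (x (j - 1)))"
    by (rule Lim_transform_eventually)
  then show ?thesis
    using assms(2) by (auto simp: trace_plus_def intro!: tendsto_Lim)
qed

section \<open>The spatial operators on the diagonal\<close>

text \<open>
  Only the component of the unknown that is passed first enters the volume term, and each flux takes
  its mean from that component and its jump from the other one.
\<close>

lemma D_phi_eq_D_u_swap: "D_phi \<epsilon> N x j (u, \<phi>) \<psi> = D_u \<epsilon> N x j (\<phi>, u) \<psi>"
  by (simp add: D_phi_def D_u_def flux_phi_def flux_u_def)

text \<open>
  The integrand is the derivative of \<open>v v\<^sub>x\<^sub>x - v\<^sub>x\<^sup>2 / 2\<close>, which is evaluated at the end points of the
  cell by one-sided limits.
\<close>

lemma integral_cell_self_dx3: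
  assumes "mesh N x" "j \<in> {1..N}" "v \<in> fe_space k N x"
  shows "integral (cell x j) (\<lambda>y. v y * dx 3 v y) =
      (trace_minus N x v j * trace_minus N x (dx 2 v) j - (trace_minus N x (dx 1 v) j)\<^sup>2 / 2)
    - (trace_plus N x v (j - 1) * trace_plus N x (dx 2 v) (j - 1)
        - (trace_plus N x (dx 1 v) (j - 1))\<^sup>2 / 2)"
proof -
  from fe_space_polyE[OF assms(3,2)] obtain p
    where p: "\<And>y. y \<in> cell x j \<Longrightarrow> v y = poly p y" by metis
  define F where "F y = poly p y * poly ((pderiv ^^ 2) p) y - (poly ((pderiv ^^ 1) p) y)\<^sup>2 / 2" for y
  have "((\<lambda>y. poly p y * poly ((pderiv ^^ 3) p) y) has_integral F (x j) - F (x (j - 1)))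
      {x (j - 1)..x j}"
  proof (rule fundamental_theorem_of_calculus)
    fix y
    show "(F has_vector_derivative poly p y * poly ((pderiv ^^ 3) p) y)
        (at y within {x (j - 1)..x j})"
      unfolding F_def has_real_derivative_iff_has_vector_derivative[symmetric]
      by (rule derivative_eq_intros refl poly_DERIV | simp add: numeral_eq_Suc)+
  qed (use meshD[OF assms(1,2)] in simp)
  then have "((\<lambda>y. v y * dx 3 v y) has_integral F (x j) - F (x (j - 1))) (cell x j)"
    unfolding has_integral_Icc_iff_Ioo cell_def[of x j, symmetric]
    by (rule has_integral_eq[rotated]) (simp only: dx_cell[OF p] p)
  then have "integral (cell x j) (\<lambda>y. v y * dx 3 v y) = F (x j) - F (x (j - 1))"
    by (rule integral_unique)
  then show ?thesis
    by (simp only: F_def trace_minus_cell[OF assms(1,2) p] trace_plus_cell[OF assms(1,2) p]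
        trace_minus_cell[OF assms(1,2) dx_cell[OF p]] trace_plus_cell[OF assms(1,2) dx_cell[OF p]])
qed

lemma sum_periodic_shift:
  fixes A B :: "nat \<Rightarrow> real"
  assumes "B 0 = B N"
  shows "(\<Sum>j = 1..N. A j - B (j - 1)) = (\<Sum>j = 1..N. A j - B j)"
proof -
  have "(\<Sum>j = 1..N. B j - B (j - 1)) = B N - B 0"
    by (induction N) auto
  then show ?thesis using assms by (simp add: sum_subtractf)
qed

text \<open>
  Summation over the cells pairs the left and the right boundary term at each node.  At a node, the
  central part of the flux cancels the jump of the boundary term of the integral.
\<close>

lemma sum_D_u_self:
  assumes "mesh N x" "u \<in> fe_space k N x"
  shows "(\<Sum>j = 1..N. D_u \<epsilon> N x j (u, \<phi>) u) =
    - (\<epsilon> / 2) * (\<Sum>j = 1..N. jump N x \<phi> j * jump N x (dx 2 u) j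
        - jump N x (dx 1 \<phi>) j * jump N x (dx 1 u) j + jump N x (dx 2 \<phi>) j * jump N x u j)"
proof -
  \<comment> \<open>The boundary term at a node, seen from the left or from the right cell according to \<open>tr\<close>.\<close>
  define b where "b tr j = - (tr u j * tr (dx 2 u) j - (tr (dx 1 u) j)\<^sup>2 / 2)
     + (flux_u N x (u, \<phi>) 0 j * tr (dx 2 u) j - flux_u N x (u, \<phi>) 1 j * tr (dx 1 u) j
        + flux_u N x (u, \<phi>) 2 j * tr u j)"
    for tr :: "(real \<Rightarrow> real) \<Rightarrow> nat \<Rightarrow> real" and j
  have "(\<Sum>j = 1..N. D_u \<epsilon> N x j (u, \<phi>) u)
      = (\<Sum>j = 1..N. \<epsilon> * b (trace_minus N x) j - \<epsilon> * b (trace_plus N x) (j - 1))"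
  proof (rule sum.cong[OF refl])
    fix j assume "j \<in> {1..N}"
    then show "D_u \<epsilon> N x j (u, \<phi>) u
        = \<epsilon> * b (trace_minus N x) j - \<epsilon> * b (trace_plus N x) (j - 1)"
      unfolding D_u_def prod.case b_def integral_cell_self_dx3[OF assms(1) \<open>j \<in> {1..N}\<close> assms(2)]
      by (simp add: algebra_simps)
  qed
  also have "\<dots> = (\<Sum>j = 1..N. \<epsilon> * b (trace_minus N x) j - \<epsilon> * b (trace_plus N x) j)"
    by (rule sum_periodic_shift)
      (simp add: b_def flux_u_def mean_def jump_def trace_plus_def trace_minus_def)
  also have "\<dots> = (\<Sum>j = 1..N. - (\<epsilon> / 2) * (jump N x \<phi> j * jump N x (dx 2 u) j
        - jump N x (dx 1 \<phi>) j * jump N x (dx 1 u) j + jump N x (dx 2 \<phi>) j * jump N x u j))"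
  proof (rule sum.cong[OF refl])
    fix j
    have dx0: "dx 0 = (\<lambda>f. f)" by (simp add: dx_def fun_eq_iff)
    show "\<epsilon> * b (trace_minus N x) j - \<epsilon> * b (trace_plus N x) j
        = - (\<epsilon> / 2) * (jump N x \<phi> j * jump N x (dx 2 u) j
          - jump N x (dx 1 \<phi>) j * jump N x (dx 1 u) j + jump N x (dx 2 \<phi>) j * jump N x u j)"
      unfolding b_def flux_u_def mean_def jump_def dx0 prod.case
      by (simp add: field_simps power2_eq_square)
  qed
  finally show ?thesis by (simp only: sum_distrib_left)
qed

corollary sum_D_u_eq_sum_D_phi:
  assumes "mesh N x" "u \<in> fe_space k N x" "\<phi> \<in> fe_space k N x"
  shows "(\<Sum>j = 1..N. D_u \<epsilon> N x j (u, \<phi>) u) = (\<Sum>j = 1..N. D_phi \<epsilon> N x j (u, \<phi>) \<phi>)"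
  unfolding D_phi_eq_D_u_swap sum_D_u_self[OF assms(1,2)] sum_D_u_self[OF assms(1,3)]
  by (simp add: algebra_simps)

section \<open>Lagrange interpolation\<close>

definition lagrange_basis :: "'a::field set \<Rightarrow> 'a \<Rightarrow> 'a poly" where
  "lagrange_basis Y a = (\<Prod>b\<in>Y - {a}. smult (1 / (a - b)) [:- b, 1:])"

lemma poly_lagrange_basis:
  assumes "finite Y" "a \<in> Y" "c \<in> Y"
  shows "poly (lagrange_basis Y a) c = (if c = a then 1 else 0)"
proof (cases "c = a")
  case True
  then show ?thesis unfolding lagrange_basis_def poly_prod
    by (auto intro!: prod.neutral simp flip: diff_divide_distrib split: if_splits)
next
  case False
  then show ?thesis unfolding lagrange_basis_def poly_prod
    using assms by (auto intro!: prod_zero bexI[of _ c])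
qed

lemma degree_lagrange_basis:
  assumes "finite Y" "a \<in> Y"
  shows "degree (lagrange_basis Y a) < card Y"
proof -
  have "degree (lagrange_basis Y a) \<le> (\<Sum>b\<in>Y - {a}. degree (smult (1 / (a - b)) [:- b, 1:]))"
    unfolding lagrange_basis_def using assms by (intro degree_prod_sum_le[unfolded o_def]) auto
  also have "\<dots> \<le> (\<Sum>b\<in>Y - {a}. 1)"
    by (intro sum_mono) (simp add: degree_smult_le[THEN order_trans])
  also have "\<dots> < card Y"
    using card_Diff1_less[OF assms] by (simp only: card_eq_sum)
  finally show ?thesis .
qed

lemma lagrange_interpolation:
  assumes "finite Y" "degree p < card Y"
  shows "p = (\<Sum>a\<in>Y. smult (poly p a) (lagrange_basis Y a))"
proof (rule poly_eqI_degree[of Y])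
  fix c assume "c \<in> Y"
  then show "poly p c = poly (\<Sum>a\<in>Y. smult (poly p a) (lagrange_basis Y a)) c"
    using assms(1) by (simp add: poly_sum poly_lagrange_basis if_distrib sum.delta cong: if_cong)
next
  have "degree (\<Sum>a\<in>Y. smult (poly p a) (lagrange_basis Y a)) \<le> card Y - 1"
    using degree_lagrange_basis[OF assms(1)]
    by (intro degree_sum_le assms(1) order_trans[OF degree_smult_le]) force
  then show "degree (\<Sum>a\<in>Y. smult (poly p a) (lagrange_basis Y a)) < card Y"
    using assms(2) by linarith
qed (use assms in auto)

section \<open>Time derivative of the cellwise energy\<close>

lemma fe_evolution_dt:
  assumes "fe_evolution k N x T w" "t \<in> {0..T}" "j \<in> {1..N}" "y \<in> cell x j"
  shows "((\<lambda>s. w s y) has_real_derivative dt T w t y) (at t within {0..T})"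
  using assms unfolding fe_evolution_def dt_def has_real_derivative_iff_has_vector_derivative
  by (auto simp: vector_derivative_works[symmetric])

lemma fe_evolution_interpolate:
  assumes "fe_evolution k N x T w" "t \<in> {0..T}" "j \<in> {1..N}"
    and "finite Y" "card Y = Suc k" "Y \<subseteq> cell x j" "y \<in> cell x j"
  shows "w t y = (\<Sum>a\<in>Y. w t a * poly (lagrange_basis Y a) y)"
proof -
  have "w t \<in> fe_space k N x" using assms(1,2) by (simp add: fe_evolution_def)
  from fe_space_polyE[OF this assms(3)] obtain p
    where p: "degree p \<le> k" "\<And>y. y \<in> cell x j \<Longrightarrow> w t y = poly p y" by blast
  have "poly p y = poly (\<Sum>a\<in>Y. smult (poly p a) (lagrange_basis Y a)) y"
    using lagrange_interpolation[of Y p] assms(4,5) p(1) by simp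
  also have "\<dots> = (\<Sum>a\<in>Y. w t a * poly (lagrange_basis Y a) y)"
    using assms(6) by (auto simp: poly_sum p(2) intro!: sum.cong)
  finally show ?thesis using p(2) assms(7) by simp
qed

lemma poly_integrable_on_cell: "poly p integrable_on cell x j" for p :: "real poly"
proof -
  have "poly p integrable_on {x (j - 1)..x j}"
    by (intro integrable_continuous_interval continuous_intros)
  then show ?thesis
    unfolding cell_def by (simp add: integrable_on_Icc_iff_Ioo)
qed

text \<open>
  The products \<open>L a * L b\<close> have integrals that do not depend on the coefficients \<open>f\<close> and \<open>g\<close>: they form
  the mass matrix of the polynomials \<open>L a\<close>.
\<close>

lemma integral_cell_interpolants:
  fixes f g :: "real \<Rightarrow> real"
  assumes "finite Y"
  shows "integral (cell x j) (\<lambda>y. (\<Sum>a\<in>Y. f a * poly (L a) y) * (\<Sum>b\<in>Y. g b * poly (L b) y))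
      = (\<Sum>a\<in>Y. \<Sum>b\<in>Y. f a * g b * integral (cell x j) (poly (L a * L b)))"
proof -
  have "integral (cell x j) (\<lambda>y. (\<Sum>a\<in>Y. f a * poly (L a) y) * (\<Sum>b\<in>Y. g b * poly (L b) y))
      = integral (cell x j) (\<lambda>y. \<Sum>a\<in>Y. \<Sum>b\<in>Y. f a * g b * poly (L a * L b) y)"
    by (simp add: sum_product mult_ac)
  also have "\<dots> = (\<Sum>a\<in>Y. \<Sum>b\<in>Y. f a * g b * integral (cell x j) (poly (L a * L b)))"
    using assms
    by (subst integral_sum; (intro integrable_sum integrable_on_mult_right poly_integrable_on_cell)?)
      (auto intro!: sum.cong integrable_on_mult_right poly_integrable_on_cell
        simp: integral_sum integrable_on_mult_right poly_integrable_on_cell simp del: poly_mult)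
  finally show ?thesis .
qed

text \<open>
  By interpolation at \<open>k + 1\<close> points of the cell, the cellwise energy is a quadratic form, with
  constant symmetric matrix, in the values of \<open>w\<close> at these points.  The product rule applies to it
  without any exchange of derivative and integral.
\<close>

lemma has_derivative_cell_energy:
  assumes mesh: "mesh N x" and "T > 0" and w: "fe_evolution k N x T w" and t: "t \<in> {0..T}" and j: "j \<in> {1..N}"
  shows "((\<lambda>s. integral (cell x j) (\<lambda>y. (w s y)\<^sup>2)) has_real_derivative
      2 * integral (cell x j) (\<lambda>y. dt T w t y * w t y)) (at t within {0..T})"
proof -
  have "infinite (cell x j)"
    using meshD[OF mesh j] by (simp add: cell_def)
  then obtain Y where Y: "finite Y" "card Y = Suc k" "Y \<subseteq> cell x j"
    using infinite_arbitrarily_large by blast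
  define L where "L = lagrange_basis Y"
  define G where "G a b = integral (cell x j) (poly (L a * L b))" for a b
  note wL = fe_evolution_interpolate[OF w _ j Y, folded L_def]
  \<comment> \<open>At every point of the cell the time derivative is interpolated from the same \<open>k + 1\<close> values;
    positivity of \<open>T\<close> makes one-sided derivatives unique.\<close>
  have dt: "dt T w t y = (\<Sum>a\<in>Y. dt T w t a * poly (L a) y)" if y: "y \<in> cell x j" for y
    unfolding dt_def[of T w t y]
  proof (rule vector_derivative_within_closed_interval[OF \<open>T > 0\<close> t])
    have "((\<lambda>s. \<Sum>a\<in>Y. w s a * poly (L a) y) has_real_derivative
        (\<Sum>a\<in>Y. dt T w t a * poly (L a) y)) (at t within {0..T})"
      using Y(3) by (intro DERIV_sum DERIV_cmult_right fe_evolution_dt[OF w t j]) auto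
    then have "((\<lambda>s. w s y) has_real_derivative
        (\<Sum>a\<in>Y. dt T w t a * poly (L a) y)) (at t within {0..T})"
      by (rule has_field_derivative_transform_within[OF _ zero_less_one t]) (simp add: wL[OF _ y])
    then show "((\<lambda>s. w s y) has_vector_derivative
        (\<Sum>a\<in>Y. dt T w t a * poly (L a) y)) (at t within {0..T})"
      by (simp add: has_real_derivative_iff_has_vector_derivative)
  qed
  have sq: "integral (cell x j) (\<lambda>y. (w s y)\<^sup>2) = (\<Sum>a\<in>Y. \<Sum>b\<in>Y. w s a * w s b * G a b)"
    if "s \<in> {0..T}" for s
  proof -
    have "integral (cell x j) (\<lambda>y. (w s y)\<^sup>2) = integral (cell x j)
        (\<lambda>y. (\<Sum>a\<in>Y. w s a * poly (L a) y) * (\<Sum>b\<in>Y. w s b * poly (L b) y))"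
      by (intro integral_cong) (metis power2_eq_square wL[OF that])
    then show ?thesis by (simp only: G_def integral_cell_interpolants[OF Y(1)])
  qed
  have pr: "integral (cell x j) (\<lambda>y. dt T w t y * w t y)
      = (\<Sum>a\<in>Y. \<Sum>b\<in>Y. dt T w t a * w t b * G a b)"
  proof -
    have "integral (cell x j) (\<lambda>y. dt T w t y * w t y) = integral (cell x j)
        (\<lambda>y. (\<Sum>a\<in>Y. dt T w t a * poly (L a) y) * (\<Sum>b\<in>Y. w t b * poly (L b) y))"
      by (intro integral_cong) (metis dt wL[OF t])
    then show ?thesis by (simp only: G_def integral_cell_interpolants[OF Y(1)])
  qed
  have G_sym: "G a b = G b a" for a b
    by (simp add: G_def mult.commute)
  have "((\<lambda>s. \<Sum>a\<in>Y. \<Sum>b\<in>Y. w s a * w s b * G a b) has_real_derivative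
      (\<Sum>a\<in>Y. \<Sum>b\<in>Y. (dt T w t a * w t b + dt T w t b * w t a) * G a b)) (at t within {0..T})"
    using Y(3) by (intro DERIV_sum DERIV_cmult_right DERIV_mult fe_evolution_dt[OF w t j]) auto
  also have "(\<Sum>a\<in>Y. \<Sum>b\<in>Y. (dt T w t a * w t b + dt T w t b * w t a) * G a b)
      = (\<Sum>a\<in>Y. \<Sum>b\<in>Y. dt T w t a * w t b * G a b) + (\<Sum>a\<in>Y. \<Sum>b\<in>Y. dt T w t b * w t a * G a b)"
    by (simp add: sum.distrib distrib_right)
  also have "(\<Sum>a\<in>Y. \<Sum>b\<in>Y. dt T w t b * w t a * G a b) = (\<Sum>a\<in>Y. \<Sum>b\<in>Y. dt T w t a * w t b * G a b)"
    by (subst sum.swap) (simp add: G_sym)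
  finally have "((\<lambda>s. \<Sum>a\<in>Y. \<Sum>b\<in>Y. w s a * w s b * G a b) has_real_derivative
      2 * integral (cell x j) (\<lambda>y. dt T w t y * w t y)) (at t within {0..T})"
    by (simp add: pr)
  then show ?thesis
    by (rule has_field_derivative_transform_within[OF _ zero_less_one t]) (simp add: sq)
qed

section \<open>Conservation of the energy\<close>

text \<open>The nodes have measure zero, so that the cells carry the whole integral.\<close>

lemma integral_unit_interval_cells:
  fixes f :: "real \<Rightarrow> real"
  assumes "mesh N x" and "\<And>j. j \<in> {1..N} \<Longrightarrow> f integrable_on cell x j"
  shows "integral {0..1} f = (\<Sum>j = 1..N. integral (cell x j) f)"
proof -
  have "(f has_integral (\<Sum>j = 1..n. integral (cell x j) f)) {x 0..x n}" if "n \<le> N" for n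
    using that
  proof (induction n)
    case 0
    show ?case by (simp add: has_integral_refl)
  next
    case (Suc n)
    have le: "x n < x (Suc n)" using meshD[OF assms(1), of "Suc n"] Suc.prems by simp
    have "mono_on {0..N} x"
      using assms(1) by (simp add: mesh_def strict_mono_on_imp_mono_on)
    then have "x 0 \<le> x n" using Suc.prems by (auto intro: mono_onD)
    moreover have "(f has_integral integral (cell x (Suc n)) f) {x n..x (Suc n)}"
      using assms(2)[of "Suc n"] Suc.prems
      by (simp add: has_integral_Icc_iff_Ioo cell_def integrable_integral)
    ultimately have "(f has_integral (\<Sum>j = 1..n. integral (cell x j) f)
        + integral (cell x (Suc n)) f) {x 0..x (Suc n)}"
      using Suc le by (intro has_integral_combine[of "x 0" "x n"]) auto
    then show ?case by simp
  qed
  from integral_unique[OF this[of N]] show ?thesis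
    using assms(1) by (simp add: mesh_def)
qed

lemma fe_square_integrable_on_cell:
  assumes "v \<in> fe_space k N x" "j \<in> {1..N}"
  shows "(\<lambda>y. (v y)\<^sup>2) integrable_on cell x j"
proof -
  from fe_space_polyE[OF assms] obtain p
    where p: "\<And>y. y \<in> cell x j \<Longrightarrow> v y = poly p y" by metis
  show ?thesis
    using poly_integrable_on_cell[of "p\<^sup>2" x j]
    by (rule integrable_eq) (simp add: p)
qed

lemma energy_cells:
  assumes "mesh N x" "u t \<in> fe_space k N x" "\<phi> t \<in> fe_space k N x"
  shows "energy u \<phi> t =
    (\<Sum>j = 1..N. integral (cell x j) (\<lambda>y. (u t y)\<^sup>2) + integral (cell x j) (\<lambda>y. (\<phi> t y)\<^sup>2))"
  unfolding energy_def
  by (subst integral_unit_interval_cells[OF assms(1)])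
    (auto intro!: integrable_add sum.cong integral_add
      fe_square_integrable_on_cell[OF assms(2)] fe_square_integrable_on_cell[OF assms(3)])

theorem theorem2p1:
  fixes \<epsilon> \<gamma> T :: real and k N :: nat and x :: "nat \<Rightarrow> real"
    and u \<phi> :: "real \<Rightarrow> real \<Rightarrow> real"
  assumes "\<epsilon> \<noteq> 0" and "T > 0" and "k \<ge> 2"
    and "regular_mesh \<gamma> N x"
    and "uwdg_solution \<epsilon> k N x T u \<phi>"
  shows "\<forall>t\<in>{0..T}. energy u \<phi> t = energy u \<phi> 0"
proof
  have mesh: "mesh N x" using assms(4) by (simp add: regular_mesh_def)
  have ev: "fe_evolution k N x T u" "fe_evolution k N x T \<phi>"
    using assms(5) by (auto simp: uwdg_solution_def)
  then have fe: "u s \<in> fe_space k N x" "\<phi> s \<in> fe_space k N x" if "s \<in> {0..T}" for s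
    using that by (auto simp: fe_evolution_def)
  define I where "I w s j = integral (cell x j) (\<lambda>y. dt T w s y * w s y)" for w s j
  have deriv: "(energy u \<phi> has_real_derivative 0) (at s within {0..T})" if s: "s \<in> {0..T}" for s
  proof -
    have "((\<lambda>s. \<Sum>j = 1..N. integral (cell x j) (\<lambda>y. (u s y)\<^sup>2) + integral (cell x j) (\<lambda>y. (\<phi> s y)\<^sup>2))
        has_real_derivative (\<Sum>j = 1..N. 2 * I u s j + 2 * I \<phi> s j)) (at s within {0..T})"
      unfolding I_def
      by (intro DERIV_sum DERIV_add has_derivative_cell_energy[OF mesh assms(2) ev(1) s]
          has_derivative_cell_energy[OF mesh assms(2) ev(2) s])
    also have "(\<Sum>j = 1..N. 2 * I u s j + 2 * I \<phi> s j)
        = (\<Sum>j = 1..N. - 2 * D_u \<epsilon> N x j (u s, \<phi> s) (u s) + 2 * D_phi \<epsilon> N x j (u s, \<phi> s) (\<phi> s))"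
    proof (rule sum.cong[OF refl])
      \<comment> \<open>At each fixed time the solution is itself an admissible test function.\<close>
      fix j assume "j \<in> {1..N}"
      then have "I u s j + D_u \<epsilon> N x j (u s, \<phi> s) (u s) = 0"
        "I \<phi> s j - D_phi \<epsilon> N x j (u s, \<phi> s) (\<phi> s) = 0"
        using assms(5) s fe[OF s] unfolding uwdg_solution_def I_def by blast+
      then show "2 * I u s j + 2 * I \<phi> s j
          = - 2 * D_u \<epsilon> N x j (u s, \<phi> s) (u s) + 2 * D_phi \<epsilon> N x j (u s, \<phi> s) (\<phi> s)"
        by linarith
    qed
    also have "\<dots> = 0"
      using sum_D_u_eq_sum_D_phi[OF mesh fe[OF s], of \<epsilon>]
      by (simp add: sum_subtractf flip: sum_distrib_left)
    finally show ?thesis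
      by (rule has_field_derivative_transform_within[OF _ zero_less_one s])
        (simp add: energy_cells[OF mesh fe])
  qed
  fix t assume "t \<in> {0..T}"
  moreover obtain c where "\<And>s. s \<in> {0..T} \<Longrightarrow> energy u \<phi> s = c"
    using has_field_derivative_zero_constant[of "{0..T}" "energy u \<phi>"] deriv by auto
  ultimately show "energy u \<phi> t = energy u \<phi> 0" by simp
qed

end
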